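(* Let $\mu_0,\mu_1$ be probability measures on $\mathcal{X}\times\mathcal{V}$, and let $\mathcal{L}_{\mathrm{OAT}}(\mu_0,\mu_1;\alpha)$ be the OAT-FM objective and $\mathcal{A}_2^2(\mu_0,\mu_1)$ the optimal acceleration transport discrepancy. With $\alpha=2/3$, $$\mathcal{L}_{\mathrm{OAT}}(\mu_0,\mu_1;\alpha)\ \ge\ \frac{2}{27}\,\mathcal{A}_2^2(\mu_0,\mu_1),$$ and equality holds if and only if $v_1=v_0$ for $\pi^\ast$-almost every pair $((x_0,v_0),(x_1,v_1))$.
   Context: $\mathcal{X}\subset\mathbb{R}^d$ is the sample space and $\mathcal{V}\subset\mathbb{R}^d$ the velocity space (by default $\mathcal{V}=\mathbb{R}^d$). $\Pi(\mu_0,\mu_1)$ is the set of couplings of $\mu_0$ and $\mu_1$. For $z_0=(x_0,v_0)$ and $z_1=(x_1,v_1)$, with time horizon $1$, the squared acceleration cost is $$c_{\mathcal{A}}^2(z_0,z_1)=12\Big\|x_1-x_0-\frac{v_1+v_0}{2}\Big\|^2+\|v_1-v_0\|^2,$$ and $$\mathcal{A}_2^2(\mu_0,\mu_1)=\min_{\pi\in\Pi(\mu_0,\mu_1)}\mathbb{E}_{(z_0,z_1)\sim\pi}[c_{\mathcal{A}}^2(z_0,z_1)].$$ $\pi^\ast\in\Pi(\mu_0,\mu_1)$ denotes a minimizer of this problem. Let $v_\theta:\mathbb{R}^d\times[0,1]\to\mathbb{R}^d$ be a parametrized velocity field (the model). For $t\in[0,1]$ put $x_t=(1-t)x_0+t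 x_1$. For $\alpha\in[0,1]$, the per-sample cost is $$\ell_{\mathcal{A}}(z_0,z_1,t;\theta)=\alpha\Big\|\frac{x_t-x_0}{t}-\frac{v_0+v_\theta(x_t,t)}{2}\Big\|^2+(1-\alpha)\|v_\theta(x_t,t)-v_0\|^2+\alpha\Big\|\frac{x_1-x_t}{1-t}-\frac{v_\theta(x_t,t)+v_1}{2}\Big\|^2+(1-\alpha)\|v_1-v_\theta(x_t,t)\|^2,$$ where $\frac{x_t-x_0}{t}$ and $\frac{x_1-x_t}{1-t}$ are both equal to (and at $t=0,1$ are interpreted as) $x_1-x_0$. The OAT-FM objective is $$\mathcal{L}_{\mathrm{OAT}}(\mu_0,\mu_1;\alpha)=\mathbb{E}_{(z_0,z_1)\sim\pi^\ast,\ t\sim\mathrm{Unif}[0,1]}\big[\ell_{\mathcal{A}}(z_0,z_1,t;\theta)\big].$$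
   Formalization: The equality clause assumes the discrepancy is finite, and "v_1=v_0 a.e. implies equality" is claimed only if v_θ minimizes the per-sample cost at almost every sample; it fails otherwise (both measures δ at (0,0), v_θ a nonzero constant). Equality is shown to force both conditions. *)

theory Defs
  imports "HOL-Probability.Probability"
begin

text \<open>A state is a pair (position, velocity).\<close>

type_synonym 'd state = "(real ^ 'd) \<times> (real ^ 'd)"

definition couplings :: "'a measure \<Rightarrow> 'b measure \<Rightarrow> ('a \<times> 'b) measure set" where
  "couplings M N =
     {P. sets P = sets (M \<Otimes>\<^sub>M N) \<and> distr P M fst = M \<and> distr P N snd = N}"

fun acc_cost :: "'d::finite state \<Rightarrow> 'd state \<Rightarrow> real" where
  "acc_cost (x0, v0) (x1, v1) =
     12 * (norm (x1 - x0 - (v1 + v0) /\<^sub>R 2))\<^sup>2 + (norm (v1 - v0))\<^sup>2"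

text \<open>Expectations of the nonnegative costs below are taken in the extended nonnegative reals,
  so no integrability has to be presupposed.\<close>

definition expected_acc_cost :: "('d::finite state \<times> 'd state) measure \<Rightarrow> ennreal" where
  "expected_acc_cost P = (\<integral>\<^sup>+ (z0, z1). ennreal (acc_cost z0 z1) \<partial>P)"

definition acc_discrepancy :: "'d::finite state measure \<Rightarrow> 'd state measure \<Rightarrow> ennreal" where
  "acc_discrepancy M N = (INF P \<in> couplings M N. expected_acc_cost P)"

definition optimal_coupling ::
    "'d::finite state measure \<Rightarrow> 'd state measure \<Rightarrow> ('d state \<times> 'd state) measure \<Rightarrow> bool" where
  "optimal_coupling M N P \<longleftrightarrow> is_arg_min expected_acc_cost (\<lambda>Q. Q \<in> couplings M N) P"

text \<open>The velocity field \<open>v\<close> is a total function of time; only its values on \<open>[0, 1]\<close> matter.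
  The case distinctions give both difference quotients the value \<open>x1 - x0\<close> at the end points.\<close>

fun oat_loss ::
    "real \<Rightarrow> (real ^ 'd \<Rightarrow> real \<Rightarrow> real ^ 'd) \<Rightarrow> 'd::finite state \<Rightarrow> 'd state \<Rightarrow> real \<Rightarrow> real" where
  "oat_loss \<alpha> v (x0, v0) (x1, v1) t =
     (let xt = (1 - t) *\<^sub>R x0 + t *\<^sub>R x1;
          vt = v xt t;
          q0 = (if t = 0 then x1 - x0 else (xt - x0) /\<^sub>R t);
          q1 = (if t = 1 then x1 - x0 else (x1 - xt) /\<^sub>R (1 - t))
      in \<alpha> * (norm (q0 - (v0 + vt) /\<^sub>R 2))\<^sup>2 + (1 - \<alpha>) * (norm (vt - v0))\<^sup>2
       + \<alpha> * (norm (q1 - (vt + v1) /\<^sub>R 2))\<^sup>2 + (1 - \<alpha>) * (norm (v1 - vt))\<^sup>2)"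

definition sampling_measure ::
    "('d::finite state \<times> 'd state) measure \<Rightarrow> (('d state \<times> 'd state) \<times> real) measure" where
  "sampling_measure P = P \<Otimes>\<^sub>M uniform_measure lborel {0..1}"

text \<open>Meaningful for \<open>\<alpha>\<close> in \<open>[0, 1]\<close>, where the loss is nonnegative.\<close>

definition oat_objective ::
    "real \<Rightarrow> (real ^ 'd \<Rightarrow> real \<Rightarrow> real ^ 'd) \<Rightarrow> ('d::finite state \<times> 'd state) measure \<Rightarrow> ennreal" where
  "oat_objective \<alpha> v P =
     (\<integral>\<^sup>+ ((z0, z1), t). ennreal (oat_loss \<alpha> v z0 z1 t) \<partial>sampling_measure P)"

text \<open>The model minimizes the loss on almost every sample. As the loss sees the field only through
  its value at one point, comparing with arbitrary fields amounts to comparing with arbitrary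
  vectors there. This is more than minimizing \<open>oat_objective\<close> over all fields: trajectories of
  different samples may cross, and a single field need not be optimal for all of them.\<close>

definition samplewise_optimal ::
    "real \<Rightarrow> (real ^ 'd \<Rightarrow> real \<Rightarrow> real ^ 'd) \<Rightarrow> ('d::finite state \<times> 'd state) measure \<Rightarrow> bool" where
  "samplewise_optimal \<alpha> v P \<longleftrightarrow>
     (AE ((z0, z1), t) in sampling_measure P. \<forall>v'. oat_loss \<alpha> v z0 z1 t \<le> oat_loss \<alpha> v' z0 z1 t)"

end

theory Submission imports Defs begin

text \<open>Write \<open>e = x1 - x0 - (v0 + v1) / 2\<close>, \<open>d = v1 - v0\<close> and \<open>w\<close> for the value of the field. At
  \<open>\<alpha> = 2/3\<close>, completing the square in \<open>w\<close> turns the loss into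
  \<open>8/9 \<parallel>e\<parallel>\<^sup>2 + 1/4 \<parallel>d\<parallel>\<^sup>2 + \<parallel>w - w'\<parallel>\<^sup>2\<close> with \<open>w' = (v0 + v1) / 2 + 2/3 e\<close>. Subtracting
  \<open>2/27\<close> times the acceleration cost \<open>12 \<parallel>e\<parallel>\<^sup>2 + \<parallel>d\<parallel>\<^sup>2\<close> leaves the nonnegative excess
  \<open>19/108 \<parallel>d\<parallel>\<^sup>2 + \<parallel>w - w'\<parallel>\<^sup>2\<close>, and equality of the expectations means that the excess vanishes
  almost surely.\<close>

text \<open>This is \<open>w'\<close> with \<open>e\<close> expanded: the velocities get the
  coefficient 1/2 - 1/3 = 1/6. It does not depend on the time.\<close>

definition oat_minimizer :: "'d::finite state \<Rightarrow> 'd state \<Rightarrow> real ^ 'd" where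
  "oat_minimizer z0 z1 =
     (2/3) *\<^sub>R (fst z1 - fst z0) + (1/6) *\<^sub>R (snd z0 + snd z1)"

definition oat_excess ::
    "(real ^ 'd \<Rightarrow> real \<Rightarrow> real ^ 'd) \<Rightarrow> ('d::finite state \<times> 'd state) \<times> real \<Rightarrow> real" where
  "oat_excess v = (\<lambda>((z0, z1), t). 19/108 * (norm (snd z1 - snd z0))\<^sup>2
     + (norm (v ((1 - t) *\<^sub>R fst z0 + t *\<^sub>R fst z1) t - oat_minimizer z0 z1))\<^sup>2)"

lemma oat_excess_nonneg: "0 \<le> oat_excess v p"
  by (auto simp: oat_excess_def split: prod.split)

lemma oat_excess_eq_0_iff:
  "oat_excess v ((z0, z1), t) = 0 \<longleftrightarrow>
     snd z1 = snd z0 \<and> v ((1 - t) *\<^sub>R fst z0 + t *\<^sub>R fst z1) t = oat_minimizer z0 z1"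
  by (simp add: oat_excess_def add_nonneg_eq_0_iff)

lemma acc_cost_nonneg: "0 \<le> acc_cost z0 z1"
  by (cases z0; cases z1) simp

text \<open>The factor 2/27 is 8/9 divided by 12, so the \<open>e\<close> terms cancel exactly, and
  19/108 = 1/4 - 2/27 is what remains for \<open>d\<close>.\<close>

lemma complete_square:
  fixes D v0 v1 w :: "'a::real_inner"
  shows "2/3 * (norm (D - (v0 + w) /\<^sub>R 2))\<^sup>2 + 1/3 * (norm (w - v0))\<^sup>2
       + 2/3 * (norm (D - (w + v1) /\<^sub>R 2))\<^sup>2 + 1/3 * (norm (v1 - w))\<^sup>2
     = 2/27 * (12 * (norm (D - (v1 + v0) /\<^sub>R 2))\<^sup>2 + (norm (v1 - v0))\<^sup>2)
       + (19/108 * (norm (v1 - v0))\<^sup>2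
          + (norm (w - ((2/3) *\<^sub>R D + (1/6) *\<^sub>R (v0 + v1))))\<^sup>2)"
  \<comment> \<open>Orienting mixed products along the order \<open>D\<close>, \<open>v0\<close>,
    \<open>v1\<close>, \<open>w\<close> makes both sides linear combinations of the same ten inner
    products.\<close>
  unfolding power2_norm_eq_inner inner_diff_left inner_diff_right inner_add_left inner_add_right
    inner_scaleR_left inner_scaleR_right
    inner_commute[of v0 D] inner_commute[of v1 D] inner_commute[of w D] inner_commute[of v1 v0]
    inner_commute[of w v0] inner_commute[of w v1]
  by (simp add: algebra_simps add_divide_distrib diff_divide_distrib)

lemma oat_loss_decomp:
  "oat_loss (2/3) v z0 z1 t = 2/27 * acc_cost z0 z1 + oat_excess v ((z0, z1), t)"
proof -
  obtain x0 v0 x1 v1 where z: "z0 = (x0, v0)" "z1 = (x1, v1)"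
    by (cases z0; cases z1)
  define xt where "xt = (1 - t) *\<^sub>R x0 + t *\<^sub>R x1"
  have "xt - x0 = t *\<^sub>R (x1 - x0)" "x1 - xt = (1 - t) *\<^sub>R (x1 - x0)"
    by (simp_all add: xt_def algebra_simps)
  \<comment> \<open>The path is a straight line, so both quotients are the constant
    \<open>x1 - x0\<close>; the case distinctions cover exactly the zero denominators.\<close>
  then have q: "(if t = 0 then x1 - x0 else (xt - x0) /\<^sub>R t) = x1 - x0"
    "(if t = 1 then x1 - x0 else (x1 - xt) /\<^sub>R (1 - t)) = x1 - x0"
    by auto
  have \<alpha>: "1 - 2/3 = (1/3 :: real)" by simp
  show ?thesis
    using complete_square[of "x1 - x0" v0 "v xt t" v1]
    by (simp only: z oat_loss.simps Let_def xt_def[symmetric] q acc_cost.simps oat_excess_def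
        oat_minimizer_def prod.case fst_conv snd_conv \<alpha>)
qed

lemma oat_loss_minimal_iff:
  "(\<forall>v'. oat_loss (2/3) v z0 z1 t \<le> oat_loss (2/3) v' z0 z1 t) \<longleftrightarrow>
     v ((1 - t) *\<^sub>R fst z0 + t *\<^sub>R fst z1) t = oat_minimizer z0 z1" (is "?L \<longleftrightarrow> ?R")
proof
  assume ?L
  \<comment> \<open>The constant field with value \<open>w'\<close> removes the last square on this
    sample; a minimal field must do the same.\<close>
  from spec[OF this, of "\<lambda>_ _. oat_minimizer z0 z1"] show ?R
    by (simp add: oat_loss_decomp oat_excess_def)
next
  assume ?R
  then show ?L by (simp add: oat_loss_decomp oat_excess_def)
qed

lemma prob_space_coupling:
  assumes "P \<in> couplings M N" "prob_space M"
  shows "prob_space P"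
proof -
  have "sets P = sets (M \<Otimes>\<^sub>M N)" "distr P M fst = M"
    using assms(1) by (simp_all add: couplings_def)
  moreover from this(1) have "fst \<in> measurable P M"
    using measurable_fst measurable_cong_sets by blast
  ultimately show ?thesis
    using assms(2) prob_space_distrD[of fst P M] by simp
qed

text \<open>The marginals carry trace sigma-algebras. Their inclusions into the whole spaces are
  measurable, and second countability lets them be paired. Borel functions on the whole product can
  then be integrated against \<open>P\<close>.\<close>

lemma measurable_coupling_borel:
  fixes M :: "'a::second_countable_topology measure"
    and N :: "'b::second_countable_topology measure"
  assumes "P \<in> couplings M N" "sets M = sets (restrict_space borel A)"
    "sets N = sets (restrict_space borel B)"
  shows "(\<lambda>z. z) \<in> measurable P borel"
proof -
  have M: "(\<lambda>x. x) \<in> measurable M borel" and N: "(\<lambda>x. x) \<in> measurable N borel"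
    using measurable_restrict_space1[OF measurable_ident] measurable_cong_sets assms(2,3)
    by (metis id_apply eq_id_iff)+
  have "fst \<in> borel_measurable (M \<Otimes>\<^sub>M N)" "snd \<in> borel_measurable (M \<Otimes>\<^sub>M N)"
    by (rule measurable_compose[OF measurable_fst M], rule measurable_compose[OF measurable_snd N])
  then have "(\<lambda>z. (fst z, snd z)) \<in> borel_measurable (M \<Otimes>\<^sub>M N)"
    by (intro borel_measurable_Pair)
  moreover have "sets P = sets (M \<Otimes>\<^sub>M N)"
    using assms(1) by (simp add: couplings_def)
  ultimately show ?thesis
    by (simp cong: measurable_cong_sets)
qed

lemma optimal_coupling_expected_cost:
  assumes "optimal_coupling M N P"
  shows "acc_discrepancy M N = expected_acc_cost P"
  unfolding acc_discrepancy_def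
  \<comment> \<open>\<open>is_arg_min\<close> only says that no coupling is strictly cheaper; since
    the order is linear, this makes the cost of \<open>P\<close> a lower bound.\<close>
  by (rule antisym)
    (use assms in \<open>auto simp: optimal_coupling_def is_arg_min_def not_less
      intro!: INF_lower INF_greatest\<close>)

lemma acc_cost_conv:
  "acc_cost z0 z1 = 12 * (norm (fst z1 - fst z0 - (snd z1 + snd z0) /\<^sub>R 2))\<^sup>2
     + (norm (snd z1 - snd z0))\<^sup>2"
  by (cases z0; cases z1) simp

lemma measurable_acc_cost:
  "(\<lambda>(z0, z1). acc_cost z0 z1) \<in> borel_measurable (borel :: ('d::finite state \<times> 'd state) measure)"
  unfolding acc_cost_conv split_beta
  by (intro borel_measurable_continuous_onI continuous_intros)

lemma measurable_oat_excess:
  fixes v :: "real ^ 'd::finite \<Rightarrow> real \<Rightarrow> real ^ 'd"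
  assumes v: "(\<lambda>(x, t). v x t) \<in> borel_measurable (borel \<Otimes>\<^sub>M borel)"
  shows "oat_excess v \<in> borel_measurable borel"
proof -
  \<comment> \<open>\<open>?g\<close> is the continuous map from a sample to the space-time point at
    which the field is evaluated.\<close>
  let ?g = "\<lambda>p :: ('d state \<times> 'd state) \<times> real.
    ((1 - snd p) *\<^sub>R fst (fst (fst p)) + snd p *\<^sub>R fst (snd (fst p)), snd p)"
  have "?g \<in> borel_measurable borel"
    by (intro borel_measurable_continuous_onI continuous_intros)
  then have "(\<lambda>p. (\<lambda>(x, t). v x t) (?g p)) \<in> borel_measurable borel"
    using v measurable_compose unfolding borel_prod by blast
  moreover have "(\<lambda>p :: ('d state \<times> 'd state) \<times> real. oat_minimizer (fst (fst p)) (snd (fst p)))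
      \<in> borel_measurable borel"
    unfolding oat_minimizer_def by (intro borel_measurable_continuous_onI continuous_intros)
  moreover have "(\<lambda>p :: ('d state \<times> 'd state) \<times> real. snd (snd (fst p)) - snd (fst (fst p)))
      \<in> borel_measurable borel"
    by (intro borel_measurable_continuous_onI continuous_intros)
  ultimately have "(\<lambda>p. 19/108 * (norm (snd (snd (fst p)) - snd (fst (fst p))))\<^sup>2
      + (norm ((\<lambda>(x, t). v x t) (?g p) - oat_minimizer (fst (fst p)) (snd (fst p))))\<^sup>2)
      \<in> borel_measurable borel"
    by measurable
  then show ?thesis
    by (simp add: oat_excess_def split_beta')
qed

lemma prob_space_unit_interval: "prob_space (uniform_measure lborel {0..1::real})"
  by (rule prob_space_uniform_measure) auto

text \<open>As \<open>N\<close> has mass one, the first marginal of the product is \<open>M\<close>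
  itself, so null sets transfer in both directions.\<close>

lemma AE_pair_fst_iff:
  assumes "prob_space N" "Measurable.pred M Q"
  shows "(AE p in M \<Otimes>\<^sub>M N. Q (fst p)) \<longleftrightarrow> (AE x in M. Q x)"
proof -
  interpret N: prob_space N by fact
  have "(AE p in M \<Otimes>\<^sub>M N. Q (fst p)) \<longleftrightarrow> (AE x in distr (M \<Otimes>\<^sub>M N) M fst. Q x)"
    using assms(2) by (subst AE_distr_iff) (auto simp: pred_def)
  also have "distr (M \<Otimes>\<^sub>M N) M fst = M"
    by (rule N.distr_pair_fst)
  finally show ?thesis .
qed

lemma oat_objective_decomp:
  fixes P :: "('d::finite state \<times> 'd state) measure"
  assumes P: "prob_space P" "(\<lambda>z. z) \<in> measurable P borel"
    and v: "(\<lambda>(x, t). v x t) \<in> borel_measurable (borel \<Otimes>\<^sub>M borel)"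
  shows "oat_excess v \<in> borel_measurable (sampling_measure P)"
    and "oat_objective (2/3) v P =
      ennreal (2/27) * expected_acc_cost P + (\<integral>\<^sup>+ p. ennreal (oat_excess v p) \<partial>sampling_measure P)"
proof -
  let ?U = "uniform_measure lborel {0..1::real}"
  interpret U: prob_space ?U by (rule prob_space_unit_interval)
  have id: "(\<lambda>p. p) \<in> borel_measurable (P \<Otimes>\<^sub>M ?U)"
  proof -
    have "fst \<in> borel_measurable (P \<Otimes>\<^sub>M ?U)"
      by (rule measurable_compose[OF measurable_fst P(2)])
    moreover have "snd \<in> borel_measurable (P \<Otimes>\<^sub>M ?U)"
      using measurable_snd[of P ?U] by (simp cong: measurable_cong_sets)
    ultimately have "(\<lambda>p. (fst p, snd p)) \<in> borel_measurable (P \<Otimes>\<^sub>M ?U)"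
      by (rule borel_measurable_Pair)
    then show ?thesis by simp
  qed
  show E: "oat_excess v \<in> borel_measurable (sampling_measure P)"
    unfolding sampling_measure_def
    using measurable_compose[OF id measurable_oat_excess[OF v]] by simp
  have A: "(\<lambda>z. acc_cost (fst z) (snd z)) \<in> borel_measurable P"
    using measurable_compose[OF P(2) measurable_acc_cost] by (simp add: split_beta')
  then have A': "(\<lambda>p. acc_cost (fst (fst p)) (snd (fst p))) \<in> borel_measurable (P \<Otimes>\<^sub>M ?U)"
    by measurable
  have "oat_objective (2/3) v P = (\<integral>\<^sup>+ p. ennreal (2/27) * ennreal (acc_cost (fst (fst p)) (snd (fst p)))
      + ennreal (oat_excess v p) \<partial>(P \<Otimes>\<^sub>M ?U))"
    unfolding oat_objective_def sampling_measure_def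
    by (intro nn_integral_cong)
      (simp add: oat_loss_decomp split_beta' acc_cost_nonneg oat_excess_nonneg
        flip: ennreal_mult ennreal_plus)
  also have "\<dots> = ennreal (2/27) * (\<integral>\<^sup>+ p. ennreal (acc_cost (fst (fst p)) (snd (fst p))) \<partial>(P \<Otimes>\<^sub>M ?U))
      + (\<integral>\<^sup>+ p. ennreal (oat_excess v p) \<partial>(P \<Otimes>\<^sub>M ?U))"
    using A' E by (simp add: nn_integral_add nn_integral_cmult sampling_measure_def)
  also have "(\<integral>\<^sup>+ p. ennreal (acc_cost (fst (fst p)) (snd (fst p))) \<partial>(P \<Otimes>\<^sub>M ?U))
      = expected_acc_cost P"
    \<comment> \<open>By Tonelli, the inner integral over time is that of a constant against a
      measure of mass one.\<close>
    using A' U.emeasure_space_1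
    by (subst U.nn_integral_fst[symmetric]) (simp_all add: expected_acc_cost_def split_beta')
  finally show "oat_objective (2/3) v P =
      ennreal (2/27) * expected_acc_cost P + (\<integral>\<^sup>+ p. ennreal (oat_excess v p) \<partial>sampling_measure P)"
    by (simp add: sampling_measure_def)
qed

theorem theorem3:
  fixes X V :: "(real ^ 'd::finite) set"
    and \<mu>0 \<mu>1 :: "'d state measure"
    and \<pi> :: "('d state \<times> 'd state) measure"
    and v :: "real ^ 'd \<Rightarrow> real \<Rightarrow> real ^ 'd"
  assumes "prob_space \<mu>0" and "sets \<mu>0 = sets (restrict_space borel (X \<times> V))"
    and "prob_space \<mu>1" and "sets \<mu>1 = sets (restrict_space borel (X \<times> V))"
    and "optimal_coupling \<mu>0 \<mu>1 \<pi>"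
    and "(\<lambda>(x, t). v x t) \<in> borel_measurable (borel \<Otimes>\<^sub>M borel)"
  shows "oat_objective (2/3) v \<pi> \<ge> ennreal (2/27) * acc_discrepancy \<mu>0 \<mu>1
    \<and> (acc_discrepancy \<mu>0 \<mu>1 < \<infinity> \<longrightarrow>
        (samplewise_optimal (2/3) v \<pi> \<longrightarrow>
           (oat_objective (2/3) v \<pi> = ennreal (2/27) * acc_discrepancy \<mu>0 \<mu>1
              \<longleftrightarrow> (AE ((x0, v0), (x1, v1)) in \<pi>. v1 = v0)))
      \<and> (oat_objective (2/3) v \<pi> = ennreal (2/27) * acc_discrepancy \<mu>0 \<mu>1 \<longrightarrow>
           (AE ((x0, v0), (x1, v1)) in \<pi>. v1 = v0) \<and> samplewise_optimal (2/3) v \<pi>))"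
proof -
  have coup: "\<pi> \<in> couplings \<mu>0 \<mu>1"
    using assms(5) by (simp add: optimal_coupling_def is_arg_min_def)
  have prob: "prob_space \<pi>"
    using coup assms(1) by (rule prob_space_coupling)
  have id: "(\<lambda>z. z) \<in> measurable \<pi> borel"
    using coup assms(2,4) by (rule measurable_coupling_borel)
  let ?S = "sampling_measure \<pi>"
  let ?E = "\<integral>\<^sup>+ p. ennreal (oat_excess v p) \<partial>?S"
  note E = oat_objective_decomp(1)[OF prob id assms(6)]
  have obj: "oat_objective (2/3) v \<pi> = ennreal (2/27) * acc_discrepancy \<mu>0 \<mu>1 + ?E"
    unfolding optimal_coupling_expected_cost[OF assms(5)]
    by (rule oat_objective_decomp(2)[OF prob id assms(6)])
  let ?rest = "AE ((x0, v0), (x1, v1)) in \<pi>. v1 = v0"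
  \<comment> \<open>Closedness supplies the measurability needed to move the almost-everywhere
    statement between \<open>\<pi>\<close> and \<open>?S\<close>.\<close>
  have "closed {z :: 'd state \<times> 'd state. snd (snd z) = snd (fst z)}"
    by (intro closed_Collect_eq continuous_intros)
  then have "Measurable.pred borel (\<lambda>z :: 'd state \<times> 'd state. snd (snd z) = snd (fst z))"
    by (simp add: pred_def)
  from measurable_compose[OF id this]
  have rest: "?rest \<longleftrightarrow> (AE p in ?S. snd (snd (fst p)) = snd (fst (fst p)))"
    unfolding sampling_measure_def
    by (subst AE_pair_fst_iff[where Q = "\<lambda>z. snd (snd z) = snd (fst z)"])
      (simp_all add: prob_space_unit_interval split_beta')
  have opt: "samplewise_optimal (2/3) v \<pi> \<longleftrightarrow>
      (AE p in ?S. v ((1 - snd p) *\<^sub>R fst (fst (fst p)) + snd p *\<^sub>R fst (snd (fst p))) (snd p)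
        = oat_minimizer (fst (fst p)) (snd (fst p)))"
    by (simp add: samplewise_optimal_def oat_loss_minimal_iff split_beta')
  have "?E = 0 \<longleftrightarrow> (AE p in ?S. oat_excess v p = 0)"
    using E by (simp add: nn_integral_0_iff_AE ennreal_eq_0_iff antisym_conv oat_excess_nonneg)
  also have "\<dots> \<longleftrightarrow> ?rest \<and> samplewise_optimal (2/3) v \<pi>"
    unfolding rest opt AE_conj_iff[symmetric]
    by (rule AE_cong) (metis oat_excess_eq_0_iff prod.collapse)
  finally have zero: "?E = 0 \<longleftrightarrow> ?rest \<and> samplewise_optimal (2/3) v \<pi>" .
  \<comment> \<open>Cancelling the common summand is valid only if it is finite: at infinite
    discrepancy equality holds whatever \<open>?E\<close> is.\<close>
  have eq: "oat_objective (2/3) v \<pi> = ennreal (2/27) * acc_discrepancy \<mu>0 \<mu>1 \<longleftrightarrow> ?E = 0"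
    if "acc_discrepancy \<mu>0 \<mu>1 < \<infinity>"
  proof -
    have "ennreal (2/27) * acc_discrepancy \<mu>0 \<mu>1 \<noteq> \<infinity>"
      using that by (simp add: ennreal_mult_eq_top_iff)
    then show ?thesis
      unfolding obj using ennreal_add_left_cancel[of _ ?E 0] by simp
  qed
  \<comment> \<open>The bound holds because \<open>?E\<close> is nonnegative. By
    \<open>zero\<close>, equality yields both almost-sure conditions, and under samplewise
    optimality it reduces to \<open>?rest\<close>.\<close>
  show ?thesis
    using eq zero by (auto simp: obj)
qed

end
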